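(* Let $n\ge 1$ be an integer, and let $G$ be either an infinite $\delta$-regular tree, or a finite $\delta$-regular graph of order $m$ with girth greater than $2n$. Let $v$ be a vertex of $G$. Then the number $W_{2n}$ of closed walks of length $2n$ at $v$ in $G$ (walks of length $2n$ that start and end at $v$) is $$W_{2n}=\sum_{k=1}^{n}\delta^{k}(\delta-1)^{n-k}\,C_{n-1,n-k},$$ where $C_{n,k}$ denotes the entries of Catalan's triangle.
   Context: Graphs are simple and undirected, and $\delta$ is a (finite) integer. Catalan's triangle: for integers $0\le k\le n$, $C_{n,k}$ is the number of lattice paths in the coordinate plane (with unit steps right and up) from $(0,0)$ to $(n,k)$ that do not go above the line $y=x$; explicitly $C_{n,k}=\frac{n-k+1}{n+1}\binom{n+k}{n}$. The convention $0^0=1$ is used. *)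

theory Defs
  imports
    "HOL-Library.Extended_Nat"
    "Graph_Theory.Pair_Digraph"
    "Graph_Theory.Digraph_Component"
    "Graph_Theory.Vertex_Walk"
begin

text \<open>
  A simple undirected graph, finite or infinite, is a pair digraph satisfying
  \<^locale>\<open>pair_bidirected_digraph\<close>: its arc set is a symmetric irreflexive relation on its
  vertices, and an edge is a pair of opposite arcs.
\<close>

text \<open>
  The outgoing arcs of a vertex correspond to its neighbours. Finiteness is required separately
  because \<^const>\<open>out_degree\<close> is defined by \<^const>\<open>card\<close>, which is \<open>0\<close> on infinite sets.
\<close>

definition regular_graph :: "nat \<Rightarrow> 'a pair_pre_digraph \<Rightarrow> bool" where
  "regular_graph d G \<longleftrightarrow>
     (\<forall>u \<in> pverts G. finite (out_arcs (with_proj G) u) \<and> out_degree (with_proj G) u = d)"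

text \<open>
  The library's \<open>cycle\<close>, \<open>forest\<close> and \<open>tree\<close> do not fit here: they count \<open>u, v, u\<close> as a cycle, so
  every edge of a symmetric digraph would be one. A cycle is written as a closed walk that repeats
  its initial vertex at the end.
\<close>

definition graph_cycle :: "'a pair_pre_digraph \<Rightarrow> 'a vwalk \<Rightarrow> bool" where
  "graph_cycle G p \<longleftrightarrow>
     vwalk p (with_proj G) \<and> hd p = last p \<and> distinct (tl p) \<and> 3 \<le> vwalk_length p"

definition graph_tree :: "'a pair_pre_digraph \<Rightarrow> bool" where
  "graph_tree G \<longleftrightarrow> Digraph_Component.connected (with_proj G) \<and> \<not> (\<exists>p. graph_cycle G p)"

text \<open>The girth of an acyclic graph is \<open>\<infinity>\<close>, the infimum of the empty set.\<close>

definition girth :: "'a pair_pre_digraph \<Rightarrow> enat" where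
  "girth G = (INF p \<in> {p. graph_cycle G p}. enat (vwalk_length p))"

definition closed_walks :: "'a pair_pre_digraph \<Rightarrow> 'a \<Rightarrow> nat \<Rightarrow> 'a vwalk set" where
  "closed_walks G v l =
     {p. vwalk p (with_proj G) \<and> vwalk_length p = l \<and> hd p = v \<and> last p = v}"

datatype step = Right | Up

text \<open>
  A lattice path from the origin is given by its list of unit steps, and \<open>take i p\<close> leads to its
  \<open>i\<close>-th lattice point.
\<close>

definition lattice_paths :: "nat \<Rightarrow> nat \<Rightarrow> step list set" where
  "lattice_paths n k =
     {p. count_list p Right = n \<and> count_list p Up = k \<and>
         (\<forall>i \<le> length p. count_list (take i p) Up \<le> count_list (take i p) Right)}"

definition catalan_triangle :: "nat \<Rightarrow> nat \<Rightarrow> nat" where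
  "catalan_triangle n k = card (lattice_paths n k)"

end

theory Submission
  imports Defs
begin

text \<open>
  Read a walk from \<open>v\<close> step by step while keeping its reduction on a stack: a step back to the
  second entry pops the stack, every other step pushes. A non-backtracking closed walk of positive
  length contains a cycle, so below the girth a walk is closed iff its reduction is trivial. From
  height \<open>0\<close> there are \<open>\<delta>\<close> pushes, from a positive height one pop and \<open>\<delta> - 1\<close> pushes; hence the
  walks are weighted Dyck paths. Deleting the pushes from height \<open>0\<close> turns these into
  the paths counted by Catalan's triangle.
\<close>

section \<open>Catalan's triangle\<close>

lemma length_eq_count_steps: "length p = count_list p Right + count_list p Up"
proof (induction p)
  case (Cons s p)
  then show ?case by (cases s) auto
qed simp

lemma finite_lattice_paths [simp]: "finite (lattice_paths n k)"
proof (rule finite_subset)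
  have "(UNIV :: step set) = {Right, Up}"
    using step.exhaust by auto
  then have "finite (UNIV :: step set)"
    by (metis finite.emptyI finite.insertI)
  then show "finite {p :: step list. set p \<subseteq> UNIV \<and> length p = n + k}"
    by (rule finite_lists_length_eq)
  show "lattice_paths n k \<subseteq> {p. set p \<subseteq> UNIV \<and> length p = n + k}"
    by (auto simp: lattice_paths_def length_eq_count_steps)
qed

lemma lattice_paths_le: "p \<in> lattice_paths n k \<Longrightarrow> k \<le> n"
  unfolding lattice_paths_def by force

lemma append_Right_in_lattice_paths:
  "p @ [Right] \<in> lattice_paths n k \<longleftrightarrow> (\<exists>n'. n = Suc n' \<and> p \<in> lattice_paths n' k)"
proof -
  have "(\<forall>i\<le>Suc (length p). count_list (take i (p @ [Right])) Up
            \<le> count_list (take i (p @ [Right])) Right) \<longleftrightarrow>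
        (\<forall>i\<le>length p. count_list (take i p) Up \<le> count_list (take i p) Right)"
    by (fastforce simp: le_Suc_eq)
  then show ?thesis by (auto simp: lattice_paths_def)
qed

text \<open>The only new prefix is the whole path. A final \<open>Right\<close> cannot violate the
  condition there, while a final \<open>Up\<close> requires \<open>Suc k' \<le> n\<close>.\<close>

lemma append_Up_in_lattice_paths:
  "p @ [Up] \<in> lattice_paths n k \<longleftrightarrow> (\<exists>k'. k = Suc k' \<and> k' < n \<and> p \<in> lattice_paths n k')"
proof -
  have "(\<forall>i\<le>Suc (length p). count_list (take i (p @ [Up])) Up
            \<le> count_list (take i (p @ [Up])) Right) \<longleftrightarrow>
        count_list p Up < count_list p Right \<and>
        (\<forall>i\<le>length p. count_list (take i p) Up \<le> count_list (take i p) Right)"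
    by (auto simp: le_Suc_eq Suc_le_eq)
  then show ?thesis by (auto simp: lattice_paths_def)
qed

text \<open>Entries beyond the diagonal vanish, so sums may include the index \<open>0\<close>,
  whose entry lies one place outside the triangle.\<close>

lemma catalan_triangle_eq_0: "n < k \<Longrightarrow> catalan_triangle n k = 0"
  unfolding catalan_triangle_def using lattice_paths_le by fastforce

lemma Nil_in_lattice_paths: "[] \<in> lattice_paths n k \<longleftrightarrow> n = 0 \<and> k = 0"
  by (auto simp: lattice_paths_def)

lemma catalan_triangle_0_0: "catalan_triangle 0 0 = 1"
proof -
  have "p \<in> lattice_paths 0 0 \<longleftrightarrow> p = []" for p
    using length_eq_count_steps[of p] by (auto simp: lattice_paths_def)
  then have "lattice_paths 0 0 = {[]}" by blast
  then show ?thesis by (simp add: catalan_triangle_def)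
qed

lemma catalan_triangle_Suc_0: "catalan_triangle (Suc n) 0 = catalan_triangle n 0"
proof -
  have "p \<in> lattice_paths (Suc n) 0 \<longleftrightarrow> p \<in> (\<lambda>p. p @ [Right]) ` lattice_paths n 0" for p
  proof (cases p rule: rev_cases)
    case (snoc q s)
    then show ?thesis
      by (cases s) (auto simp: append_Right_in_lattice_paths append_Up_in_lattice_paths)
  qed (auto simp: Nil_in_lattice_paths)
  then have "lattice_paths (Suc n) 0 = (\<lambda>p. p @ [Right]) ` lattice_paths n 0"
    by blast
  then show ?thesis
    by (simp add: catalan_triangle_def card_image inj_on_def)
qed

lemma catalan_triangle_0_right: "catalan_triangle n 0 = 1"
  by (induction n) (simp_all add: catalan_triangle_0_0 catalan_triangle_Suc_0)

text \<open>Split by the last step. The bound on \<open>k\<close> keeps the endpoint on or below the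
  diagonal, so that a final \<open>Up\<close> is allowed; for \<open>k = n\<close> the first summand
  is zero.\<close>

lemma catalan_triangle_Suc_Suc:
  assumes "k \<le> n"
  shows "catalan_triangle (Suc n) (Suc k) = catalan_triangle n (Suc k) + catalan_triangle (Suc n) k"
proof -
  let ?R = "(\<lambda>p. p @ [Right]) ` lattice_paths n (Suc k)"
  let ?U = "(\<lambda>p. p @ [Up]) ` lattice_paths (Suc n) k"
  have "p \<in> lattice_paths (Suc n) (Suc k) \<longleftrightarrow> p \<in> ?R \<union> ?U" for p
  proof (cases p rule: rev_cases)
    case (snoc q s)
    then show ?thesis using assms
      by (cases s) (auto simp: append_Right_in_lattice_paths append_Up_in_lattice_paths)
  qed (auto simp: Nil_in_lattice_paths)
  then have "lattice_paths (Suc n) (Suc k) = ?R \<union> ?U" by blast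
  moreover have "card (?R \<union> ?U) = card ?R + card ?U"
    by (rule card_Un_disjoint) auto
  ultimately show ?thesis
    by (simp add: catalan_triangle_def card_image inj_on_def)
qed

section \<open>Weighted Dyck paths\<close>

text \<open>Weighted number of paths with \<open>t\<close> unit steps from height \<open>h\<close>
  down to \<open>0\<close>: a down step has weight 1, an up step weight \<open>d\<close> at height
  \<open>0\<close> and \<open>d - 1\<close> above it. Integer values keep \<open>d - 1\<close>
  correct for \<open>d = 0\<close>.\<close>

fun descents :: "int \<Rightarrow> nat \<Rightarrow> nat \<Rightarrow> int" where
  "descents d 0 0 = 1"
| "descents d 0 (Suc h) = 0"
| "descents d (Suc t) 0 = d * descents d t 1"
| "descents d (Suc t) (Suc h) = descents d t h + (d - 1) * descents d t (Suc (Suc h))"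

lemma descents_eq_0: "t < h \<Longrightarrow> descents d t h = 0"
  by (induction d t h rule: descents.induct) auto

text \<open>The index \<open>i\<close> counts the pushes from height \<open>0\<close>, \<open>j\<close> counts all pushes.\<close>

lemma descents_eq_sum:
  assumes "1 \<le> h + j"
  shows "descents d (h + 2 * j) h =
    (\<Sum>i\<le>j. d ^ i * (d - 1) ^ (j - i) * int (catalan_triangle (h + j - 1) (j - i)))"
  using assms
\<comment> \<open>Induction on the number of steps: \<open>j\<close> pushes and \<open>h + j\<close>
  pops.\<close>
proof (induction "h + 2 * j" arbitrary: h j rule: less_induct)
  case less
  let ?f = "\<lambda>i j c. d ^ i * (d - 1) ^ (j - i) * int c"
  show ?case
  proof (cases h)
    case 0
    with less.prems obtain k where j: "j = Suc k" by (cases j) auto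
    have "descents d (h + 2 * j) h = d * descents d (1 + 2 * k) 1"
      using 0 j by simp
    also have "descents d (1 + 2 * k) 1 = (\<Sum>i\<le>k. ?f i k (catalan_triangle k (k - i)))"
      using less.hyps[of 1 k] 0 j by simp
    also have "d * \<dots> = (\<Sum>i\<le>k. ?f (Suc i) j (catalan_triangle k (j - Suc i)))"
      by (simp add: j sum_distrib_left mult.assoc)
    \<comment> \<open>The forced push from height \<open>0\<close> shifts \<open>i\<close> by one;
      the added term \<open>i = 0\<close> contains the entry \<open>(k, Suc k)\<close>, which is
      zero.\<close>
    also have "\<dots> = (\<Sum>i\<le>j. ?f i j (catalan_triangle k (j - i)))"
      by (simp add: j sum.atMost_Suc_shift catalan_triangle_eq_0 del: sum.atMost_Suc)
    finally show ?thesis using 0 j by simp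
  next
    case (Suc g)
    show ?thesis
    proof (cases j)
      case 0
      \<comment> \<open>No pushes remain, so the path is a pure descent.\<close>
      have "descents d g g = 1"
        using less.hyps[of g 0] Suc 0 by (cases g) (simp_all add: catalan_triangle_0_right)
      then show ?thesis
        using Suc 0 by (simp add: descents_eq_0 catalan_triangle_0_right)
    next
      case j: (Suc k)
      have "descents d (h + 2 * j) h = descents d (g + 2 * j) g
          + (d - 1) * descents d (Suc (Suc g) + 2 * k) (Suc (Suc g))"
        using Suc j by simp
      also have "descents d (g + 2 * j) g = (\<Sum>i\<le>j. ?f i j (catalan_triangle (g + k) (j - i)))"
        using less.hyps[of g j] Suc j by simp
      \<comment> \<open>The term \<open>i = j\<close> is split off because the push branch, with
        only \<open>k\<close> pushes left, has no counterpart to it.\<close>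
      also have "\<dots> = (\<Sum>i\<le>k. ?f i j (catalan_triangle (g + k) (j - i))) + d ^ j"
        by (simp add: j catalan_triangle_0_right)
      also have "descents d (Suc (Suc g) + 2 * k) (Suc (Suc g))
          = (\<Sum>i\<le>k. ?f i k (catalan_triangle (Suc (g + k)) (k - i)))"
        using less.hyps[of "Suc (Suc g)" k] Suc j by simp
      also have "(d - 1) * \<dots> = (\<Sum>i\<le>k. ?f i j (catalan_triangle (Suc (g + k)) (k - i)))"
        unfolding sum_distrib_left by (intro sum.cong) (auto simp: j Suc_diff_le)
      \<comment> \<open>Termwise Catalan recursion at row \<open>Suc (g + k)\<close> and column
        \<open>Suc (k - i)\<close>: the pop supplies the entry in the row before, the push the entry
        in the column before.\<close>
      also have "(\<Sum>i\<le>k. ?f i j (catalan_triangle (g + k) (j - i))) + d ^ j + \<dots>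
          = (\<Sum>i\<le>k. ?f i j (catalan_triangle (Suc (g + k)) (j - i))) + d ^ j"
        unfolding sum.distrib[symmetric] add.commute[of _ "d ^ j"] add.assoc
        by (intro arg_cong2[where f = "(+)"] sum.cong)
          (auto simp: j Suc_diff_le catalan_triangle_Suc_Suc algebra_simps)
      also have "\<dots> = (\<Sum>i\<le>j. ?f i j (catalan_triangle (Suc (g + k)) (j - i)))"
        by (simp add: j catalan_triangle_0_right)
      finally show ?thesis using Suc j by simp
    qed
  qed
qed

section \<open>Reduction of walks\<close>

fun nonbacktracking :: "'a list \<Rightarrow> bool" where
  "nonbacktracking (x # y # z # p) \<longleftrightarrow> x \<noteq> z \<and> nonbacktracking (y # z # p)"
| "nonbacktracking _ \<longleftrightarrow> True"

lemma nonbacktracking_appendD: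
  assumes "nonbacktracking (p @ q)"
  shows "nonbacktracking p" "nonbacktracking q"
proof -
  show "nonbacktracking p"
    using assms by (induction p rule: nonbacktracking.induct) auto
  have "nonbacktracking (x # r) \<Longrightarrow> nonbacktracking r" for x and r :: "'a list"
    by (cases "x # r" rule: nonbacktracking.cases) auto
  then show "nonbacktracking q"
    using assms by (induction p) auto
qed

text \<open>A repeated vertex in the tail cuts out a strictly shorter closed segment, which is again
  nonbacktracking; a shortest one is a cycle. Four list entries mean three edges: irreflexivity
  excludes one edge, nonbacktracking excludes two.\<close>

lemma nonbacktracking_imp_cycle:
  assumes "\<And>x. \<not> E x x"
    and "successively E p" "nonbacktracking p" "hd p = last p" "2 \<le> length p"
  shows "\<exists>c. successively E c \<and> set c \<subseteq> set p \<and> hd c = last c \<and> distinct (tl c) \<and>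
    4 \<le> length c \<and> length c \<le> length p"
  using assms(2-)
proof (induction "length p" arbitrary: p rule: less_induct)
  case less
  show ?case
  proof (cases "distinct (tl p)")
    case True
    have "4 \<le> length p"
    proof (rule ccontr)
      assume "\<not> 4 \<le> length p"
      with less.prems(4) consider x y where "p = [x, y]" | x y z where "p = [x, y, z]"
        by (cases p rule: nonbacktracking.cases) (auto simp: Suc_le_eq)
      then show False using less.prems assms(1) by cases auto
    qed
    with True less.prems show ?thesis by blast
  next
    case False
    then obtain xs ys zs y where tl: "tl p = xs @ [y] @ ys @ [y] @ zs"
      using not_distinct_decomp by blast
    let ?q = "y # ys @ [y]"
    obtain x where p: "p = (x # xs) @ ?q @ zs"
      using tl less.prems(4) by (cases p) auto
    have "successively E ?q" using less.prems(1) unfolding p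
      by (metis successively_append_iff)
    moreover have "nonbacktracking ?q"
      using less.prems(2) unfolding p by (metis nonbacktracking_appendD)
    ultimately obtain c where "successively E c" "set c \<subseteq> set ?q" "hd c = last c"
      "distinct (tl c)" "4 \<le> length c" "length c \<le> length ?q"
      using less.hyps[of ?q] p by auto
    moreover have "set ?q \<subseteq> set p" "length ?q \<le> length p" by (auto simp: p)
    ultimately show ?thesis by (meson order_trans)
  qed
qed

text \<open>The stack is the reduced walk in reverse: its head is the current vertex, its last entry
  the start. A singleton has no predecessor to return to, so it always grows.\<close>

fun reduce_step :: "'a list \<Rightarrow> 'a \<Rightarrow> 'a list" where
  "reduce_step (x # y # s) w = (if w = y then y # s else w # x # y # s)"
| "reduce_step s w = w # s"

lemma reduce_step_simps [simp]:
  "reduce_step s w \<noteq> []" "hd (reduce_step s w) = w"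
  "s \<noteq> [] \<Longrightarrow> last (reduce_step s w) = last s"
  by (cases "(s, w)" rule: reduce_step.cases; auto)+

lemma length_reduce_step_le: "length (reduce_step s w) \<le> Suc (length s)"
  by (cases "(s, w)" rule: reduce_step.cases) auto

lemma set_reduce_step_subset: "set (reduce_step s w) \<subseteq> insert w (set s)"
  by (cases "(s, w)" rule: reduce_step.cases) auto

lemma nonbacktracking_reduce_step:
  "nonbacktracking s \<Longrightarrow> nonbacktracking (reduce_step s w)"
  by (cases s rule: nonbacktracking.cases) auto

text \<open>Symmetry enters because the stack is reversed: the step goes from \<open>hd s\<close> to
  \<open>w\<close>, but the new list needs \<open>E w (hd s)\<close>.\<close>

lemma successively_reduce_step:
  assumes "symp E" "successively E s" "s \<noteq> []" "E (hd s) w"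
  shows "successively E (reduce_step s w)"
  using assms by (cases "(s, w)" rule: reduce_step.cases) (auto dest: sympD)

lemma reduce_simps [simp]:
  assumes "s \<noteq> []"
  shows "foldl reduce_step s xs \<noteq> []"
    and "hd (foldl reduce_step s xs) = last (hd s # xs)"
    and "last (foldl reduce_step s xs) = last s"
  using assms by (induction xs arbitrary: s) auto

lemma length_reduce_le: "length (foldl reduce_step s xs) \<le> length s + length xs"
proof (induction xs arbitrary: s)
  case (Cons w xs)
  then show ?case
    using order_trans[OF Cons.IH[of "reduce_step s w"] add_right_mono[OF length_reduce_step_le]]
    by simp
qed simp

lemma set_reduce_subset: "set (foldl reduce_step s xs) \<subseteq> set s \<union> set xs"
proof (induction xs arbitrary: s)
  case (Cons w xs)
  then show ?case
    using set_reduce_step_subset[of s w] Cons.IH[of "reduce_step s w"] by auto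
qed simp

lemma nonbacktracking_reduce:
  "nonbacktracking s \<Longrightarrow> nonbacktracking (foldl reduce_step s xs)"
  by (induction xs arbitrary: s) (auto simp: nonbacktracking_reduce_step)

lemma successively_reduce:
  assumes "symp E" "successively E s" "s \<noteq> []" "successively E (hd s # xs)"
  shows "successively E (foldl reduce_step s xs)"
  using assms(2-)
proof (induction xs arbitrary: s)
  case (Cons w xs)
  then show ?case using successively_reduce_step[OF assms(1)] by auto
qed simp

text \<open>The continuations \<open>xs\<close> of a walk standing at \<open>hd s\<close> with stack
  \<open>s\<close> that bring the stack down to its bottom entry. Arbitrary stacks are allowed so
  that the count can go by induction on \<open>t\<close>.\<close>

definition reducing_walks :: "('a \<Rightarrow> 'a \<Rightarrow> bool) \<Rightarrow> nat \<Rightarrow> 'a list \<Rightarrow> 'a list set" where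
  "reducing_walks E t s =
    {xs. length xs = t \<and> successively E (hd s # xs) \<and> foldl reduce_step s xs = [last s]}"

lemma reducing_walks_0: "s \<noteq> [] \<Longrightarrow> reducing_walks E 0 s = (if length s = 1 then {[]} else {})"
  by (cases s) (auto simp: reducing_walks_def)

lemma reducing_walks_Suc:
  assumes "s \<noteq> []"
  shows "reducing_walks E (Suc t) s =
    (\<Union>w\<in>{w. E (hd s) w}. (#) w ` reducing_walks E t (reduce_step s w))"
  using assms by (auto simp: reducing_walks_def length_Suc_conv)

text \<open>The count depends on the stack only through its height: sorting by the first vertex
  \<open>w\<close> reproduces the recursion of \<open>descents\<close>.\<close>

lemma card_reducing_walks:
  assumes "symp E" and closed: "\<And>x y. E x y \<Longrightarrow> y \<in> V"
    and regular: "\<And>x. x \<in> V \<Longrightarrow> finite {y. E x y} \<and> card {y. E x y} = d"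
    and "s \<noteq> []" "successively E s" "set s \<subseteq> V"
  shows "finite (reducing_walks E t s) \<and>
    int (card (reducing_walks E t s)) = descents (int d) t (length s - 1)"
  using assms(4-)
proof (induction t arbitrary: s)
  case 0
  then show ?case
    by (cases s; cases "tl s") (auto simp: reducing_walks_0)
next
  case (Suc t)
  let ?N = "{w. E (hd s) w}"
  let ?r = "\<lambda>w. reduce_step s w"
  have hd: "hd s \<in> V" using Suc.prems by auto
  have N: "finite ?N" "card ?N = d" using regular[OF hd] by auto
  have IH: "finite (reducing_walks E t (?r w))"
    "int (card (reducing_walks E t (?r w))) = descents (int d) t (length (?r w) - 1)"
    if "w \<in> ?N" for w
  proof -
    have "set (?r w) \<subseteq> V"
      using closed[of "hd s" w] that Suc.prems(3) set_reduce_step_subset[of s w] by blast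
    then show "finite (reducing_walks E t (?r w))"
      "int (card (reducing_walks E t (?r w))) = descents (int d) t (length (?r w) - 1)"
      using Suc.IH[of "?r w"] successively_reduce_step[OF assms(1) Suc.prems(2,1)] that by auto
  qed
  have fin: "finite (reducing_walks E (Suc t) s)"
    using N IH by (simp add: reducing_walks_Suc Suc.prems)
  have "card (reducing_walks E (Suc t) s) = (\<Sum>w\<in>?N. card ((#) w ` reducing_walks E t (?r w)))"
    unfolding reducing_walks_Suc[OF Suc.prems(1)]
    by (rule card_UN_disjoint) (use N IH in auto)
  then have card: "int (card (reducing_walks E (Suc t) s))
      = (\<Sum>w\<in>?N. descents (int d) t (length (?r w) - 1))"
    by (simp add: card_image del: mem_Collect_eq) (rule sum.cong, use IH in auto)
  also have "\<dots> = descents (int d) (Suc t) (length s - 1)"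
  proof (cases "tl s")
    case Nil
    then obtain x where "s = [x]" using Suc.prems by (cases s) auto
    then show ?thesis using N by simp
  next
    case (Cons y s')
    then obtain x where s: "s = x # y # s'" by (cases s) auto
    \<comment> \<open>Exactly one neighbour, the second stack entry \<open>y\<close>, pops; the
      others push. Its existence gives \<open>0 < d\<close>, so the natural number
      \<open>d - 1\<close> agrees with \<open>int d - 1\<close>.\<close>
    have y: "y \<in> ?N" using Suc.prems s by simp
    then have "0 < d" using N card_gt_0_iff by blast
    have "(\<Sum>w\<in>?N. descents (int d) t (length (?r w) - 1)) =
        descents (int d) t (length s')
        + (\<Sum>w\<in>?N - {y}. descents (int d) t (length (?r w) - 1))"
      using sum.remove[OF N(1) y, of "\<lambda>w. descents (int d) t (length (?r w) - 1)"] by (simp add: s)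
    also have "(\<Sum>w\<in>?N - {y}. descents (int d) t (length (?r w) - 1))
        = (\<Sum>w\<in>?N - {y}. descents (int d) t (Suc (Suc (length s'))))"
      by (rule sum.cong) (auto simp: s)
    also have "\<dots> = (int d - 1) * descents (int d) t (Suc (Suc (length s')))"
      using N y \<open>0 < d\<close> by (simp add: of_nat_diff)
    finally show ?thesis by (simp add: s)
  qed
  finally show ?case using fin by simp
qed

section \<open>Closed walks\<close>

lemma vwalk_iff_successively:
  "vwalk p (with_proj G) \<longleftrightarrow>
    p \<noteq> [] \<and> set p \<subseteq> pverts G \<and> successively (\<lambda>x y. (x, y) \<in> parcs G) p"
proof -
  have "set (vwalk_arcs p) \<subseteq> parcs G \<longleftrightarrow> successively (\<lambda>x y. (x, y) \<in> parcs G) p"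
    by (induction p rule: vwalk_arcs.induct) auto
  then show ?thesis by (auto simp: vwalk_def)
qed

lemma girth_le: "graph_cycle G p \<Longrightarrow> girth G \<le> enat (vwalk_length p)"
  unfolding girth_def by (rule INF_lower) simp

lemma pair_bidirected_digraphD:
  assumes "pair_bidirected_digraph G"
  shows "symp (\<lambda>x y. (x, y) \<in> parcs G)"
    and "(x, x) \<notin> parcs G"
    and "(x, y) \<in> parcs G \<Longrightarrow> y \<in> pverts G"
  using assms
  by (auto simp: pair_bidirected_digraph_def pair_sym_digraph_def pair_sym_digraph_axioms_def
      pair_loopfree_digraph_def pair_loopfree_digraph_axioms_def pair_wf_digraph_def
      symmetric_def sym_def intro!: sympI)

text \<open>A closed walk with nontrivial reduction would yield a cycle of length at most
  \<open>l\<close>, below the girth. Conversely, the head of the stack is the end of the walk, so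
  trivial reduction forces closedness.\<close>

lemma closed_walks_eq_reducing_walks:
  assumes "pair_bidirected_digraph G" and "v \<in> pverts G" and "enat l < girth G"
  shows "closed_walks G v l = (#) v ` reducing_walks (\<lambda>x y. (x, y) \<in> parcs G) l [v]"
proof -
  let ?E = "\<lambda>x y. (x, y) \<in> parcs G"
  note sym = pair_bidirected_digraphD(1)[OF assms(1)]
    and irrefl = pair_bidirected_digraphD(2)[OF assms(1)]
    and closed = pair_bidirected_digraphD(3)[OF assms(1)]
  have verts: "set xs \<subseteq> pverts G" if "successively ?E (u # xs)" for u xs
    using that by (induction xs arbitrary: u) (auto dest: closed)
  have trivial: "foldl reduce_step [v] xs = [v]"
    if xs: "length xs = l" "successively ?E (v # xs)" "last (v # xs) = v" for xs
  proof (rule ccontr)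
    let ?p = "foldl reduce_step [v] xs"
    assume "?p \<noteq> [v]"
    have p: "?p \<noteq> []" "hd ?p = v" "last ?p = v" "length ?p \<le> l + 1" "set ?p \<subseteq> pverts G"
      using length_reduce_le[of "[v]" xs] set_reduce_subset[of "[v]" xs] xs verts[OF xs(2)] assms(2)
      by auto
    with \<open>?p \<noteq> [v]\<close> have "2 \<le> length ?p"
      by (cases ?p; cases "tl ?p") auto
    moreover have "successively ?E ?p"
      using successively_reduce[OF sym] xs(2) by simp
    moreover have "nonbacktracking ?p"
      by (simp add: nonbacktracking_reduce)
    ultimately obtain c where c: "successively ?E c" "set c \<subseteq> set ?p" "hd c = last c"
      "distinct (tl c)" "4 \<le> length c" "length c \<le> length ?p"
      using nonbacktracking_imp_cycle[of ?E ?p] irrefl p by auto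
    then have "graph_cycle G c"
      \<comment> \<open>\<open>vwalk_length\<close> counts edges, one fewer than list entries, so
        \<open>4 \<le> length c\<close> gives the required three edges.\<close>
      using p unfolding graph_cycle_def vwalk_iff_successively by auto
    then have "girth G \<le> enat (vwalk_length c)" by (rule girth_le)
    also have "\<dots> \<le> enat l" using c p by simp
    finally show False using assms(3) by simp
  qed
  have "p \<in> closed_walks G v l \<longleftrightarrow> p \<in> (#) v ` reducing_walks ?E l [v]" for p
  proof (cases p)
    case (Cons u xs)
    have "last (v # xs) = v" if "foldl reduce_step [v] xs = [v]"
      using reduce_simps(2)[of "[v]" xs] that by simp
    with trivial[of xs] verts[of v xs] assms(2) show ?thesis
      by (auto simp: Cons closed_walks_def reducing_walks_def vwalk_iff_successively)
  qed (auto simp: closed_walks_def vwalk_iff_successively)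
  then show ?thesis by blast
qed

theorem theorem12:
  fixes G :: "'a pair_pre_digraph" and v :: 'a and n m \<delta> :: nat
  assumes "1 \<le> n"
    and "pair_bidirected_digraph G"
    and "regular_graph \<delta> G"
    and "(infinite (pverts G) \<and> graph_tree G) \<or>
         (finite (pverts G) \<and> card (pverts G) = m \<and> girth G > enat (2 * n))"
    and "v \<in> pverts G"
  shows "int (card (closed_walks G v (2 * n))) =
    (\<Sum>k = 1..n. int \<delta> ^ k * (int \<delta> - 1) ^ (n - k) * int (catalan_triangle (n - 1) (n - k)))"
proof -
  let ?E = "\<lambda>x y. (x, y) \<in> parcs G"
  let ?f = "\<lambda>k. int \<delta> ^ k * (int \<delta> - 1) ^ (n - k) * int (catalan_triangle (n - 1) (n - k))"
  \<comment> \<open>Acyclicity makes the girth an infimum over the empty set, so the tree case and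
    the finite case share one girth bound.\<close>
  have "girth G = \<infinity>" if "graph_tree G"
    using that by (simp add: graph_tree_def girth_def top_enat_def)
  then have girth: "enat (2 * n) < girth G"
    using assms(4) by auto
  have regular: "finite {y. ?E x y} \<and> card {y. ?E x y} = \<delta>" if "x \<in> pverts G" for x
  proof -
    have "out_arcs (with_proj G) x = Pair x ` {y. ?E x y}"
      by (auto simp: out_arcs_def)
    then show ?thesis
      using assms(3) that unfolding regular_graph_def out_degree_def
      by (auto simp: card_image inj_on_def finite_image_iff)
  qed
  have "int (card (reducing_walks ?E (2 * n) [v])) = descents (int \<delta>) (0 + 2 * n) 0"
    using card_reducing_walks[of ?E "pverts G" \<delta> "[v]" "2 * n"] regular assms(5)
      pair_bidirected_digraphD(1,3)[OF assms(2)] by auto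
  also have "\<dots> = (\<Sum>k\<le>n. ?f k)"
    using descents_eq_sum[of 0 n] assms(1) by simp
  \<comment> \<open>The term \<open>k = 0\<close> contains the entry \<open>(n - 1, n)\<close>
    outside the triangle.\<close>
  also have "\<dots> = (\<Sum>k = 1..n. ?f k)"
    using assms(1)
    by (intro sum.mono_neutral_right) (auto simp: catalan_triangle_eq_0 not_le)
  finally show ?thesis
    by (simp add: closed_walks_eq_reducing_walks[OF assms(2,5) girth] card_image)
qed

end
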